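(* Let $\tau=\frac{1+\sqrt5}{2}$, let $\Gamma\subset\mathbb{R}\times\mathbb{R}$ be the lattice spanned over $\mathbb{Z}$ by the vectors $(1,1)^T$ and $(\tau,-\frac1\tau)^T$, and let $\pi_1,\pi_2:\mathbb{R}\times\mathbb{R}\to\mathbb{R}$ be the orthogonal projections to the first and second coordinate, respectively. Let $W_1=\left[-\frac1\tau,\frac{1-\frac1\tau}{2}\right)$ and $W_2=\left[\frac{1-\frac1\tau}{2},1\right)$, and define the half-Fibonacci sequences $$F_i=\{\pi_1(x)\mid x\in\Gamma,\ \pi_2(x)\in W_i\}\subset\mathbb{R},\qquad i=1,2.$$ Then $F_1$ and $F_2$ are not bounded distance equivalent.
   Context: Two discrete point sets $\Lambda,\Lambda'\subset\mathbb{R}$ are bounded distance equivalent if there are $c>0$ and a bijection $\varphi:\Lambda\to\Lambda'$ with $|x-\varphi(x)|<c$ for all $x\in\Lambda$. *)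

theory Defs
  imports "HOL-Analysis.Analysis"
begin

text \<open>
  Discreteness of the two sets is not part of the relation: the condition makes sense for
  arbitrary subsets of the line and restricts to the usual notion on discrete ones.
\<close>

definition bounded_distance_equivalent :: "real set \<Rightarrow> real set \<Rightarrow> bool" where
  "bounded_distance_equivalent L L' \<longleftrightarrow>
     (\<exists>c>0. \<exists>\<phi>. bij_betw \<phi> L L' \<and> (\<forall>x\<in>L. \<bar>x - \<phi> x\<bar> < c))"

definition golden :: real where
  "golden = (1 + sqrt 5) / 2"

definition fibonacci_lattice :: "(real \<times> real) set" where
  "fibonacci_lattice =
     {of_int a *\<^sub>R (1, 1) + of_int b *\<^sub>R (golden, - (1 / golden)) | a b :: int. True}"

definition window1 :: "real set" where
  "window1 = {- (1 / golden) ..< (1 - 1 / golden) / 2}"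

definition window2 :: "real set" where
  "window2 = {(1 - 1 / golden) / 2 ..< 1}"

definition cut_and_project :: "(real \<times> real) set \<Rightarrow> real set \<Rightarrow> real set" where
  "cut_and_project \<Gamma> W = {fst x | x. x \<in> \<Gamma> \<and> snd x \<in> W}"

definition half_fibonacci1 :: "real set" where
  "half_fibonacci1 = cut_and_project fibonacci_lattice window1"

definition half_fibonacci2 :: "real set" where
  "half_fibonacci2 = cut_and_project fibonacci_lattice window2"

end

theory Submission
  imports Defs
begin

text \<open>
  Both sets come from one sequence. Listed in increasing order, the points of the Fibonacci chain
  with window \<open>[-1/\<tau>, 1)\<close> have second coordinates that run through an orbit of the translation
  by \<open>1\<close> on the circle \<open>\<real>/\<tau>\<int>\<close>. After rescaling the window to \<open>[0,1)\<close>, the \<open>n\<close>-th point sits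
  at the fractional part of \<open>n\<tau>\<close>, and it belongs to \<open>F\<^sub>1\<close> or to \<open>F\<^sub>2\<close> according to whether this
  fractional part lies in the left or in the right half of the circle
  (\<open>half_fibonacci1_eq\<close>, \<open>half_fibonacci2_eq\<close>).

  Distinct points of the chain have distance at least \<open>1\<close>. A bijection that moves points a bounded
  distance therefore also moves indices a bounded distance, and so among the first \<open>N\<close> indices the
  numbers of points of \<open>F\<^sub>1\<close> and of \<open>F\<^sub>2\<close> differ by a bounded amount
  (\<open>bounded_distance_equivalent_imp_card_le\<close>). In other words, the sums \<open>S(N)\<close> of the signs
  \<open>+1\<close> (left half) and \<open>-1\<close> (right half) over \<open>n = 1, \<dots>, N\<close> are bounded.

  This is impossible for every irrational rotation (\<open>half_turn_balance_unbounded\<close>). It is the case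
  of an interval of length \<open>1/2\<close> in Kesten's theorem, and has a short proof by parity. If \<open>S\<close> were
  bounded, then, having integer values, it would attain its maximum at some \<open>N\<^sub>1\<close> and its minimum at
  some \<open>N\<^sub>2\<close>. Choose an odd \<open>q\<close> with \<open>q\<tau>\<close> so close to an integer that translating by \<open>q\<close>
  preserves the first \<open>max N\<^sub>1 N\<^sub>2\<close> signs. Then \<open>S(N\<^sub>i + q) = S(q) + S(N\<^sub>i)\<close>. Maximality at
  \<open>N\<^sub>1\<close> gives \<open>S(q) \<le> 0\<close>, minimality at \<open>N\<^sub>2\<close> gives \<open>S(q) \<ge> 0\<close>; but \<open>S(q)\<close> is a sum of an odd
  number of signs, hence odd.
\<close>

section \<open>Bounded distance equivalence bounds counting differences\<close>

lemma bounded_distance_equivalent_sym: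
  assumes "bounded_distance_equivalent L L'"
  shows "bounded_distance_equivalent L' L"
proof -
  from assms obtain c \<phi> where c: "c > 0" and bij: "bij_betw \<phi> L L'"
    and near: "\<forall>x\<in>L. \<bar>x - \<phi> x\<bar> < c"
    unfolding bounded_distance_equivalent_def by blast
  have "\<bar>y - inv_into L \<phi> y\<bar> < c" if "y \<in> L'" for y
  proof -
    have "inv_into L \<phi> y \<in> L" "\<phi> (inv_into L \<phi> y) = y"
      using bij that by (auto simp: bij_betw_def inv_into_into f_inv_into_f)
    then show ?thesis using near by (metis abs_minus_commute)
  qed
  then show ?thesis
    unfolding bounded_distance_equivalent_def
    using c bij_betw_inv_into[OF bij] by blast
qed

text \<open>
  The lower bound on the gaps of \<open>X\<close> turns a bound on the displacement of points into a bound \<open>D\<close>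
  on the displacement of indices. Thus the bijection injects the indices of \<open>A\<close> in \<open>[1, N]\<close> into
  those of \<open>B\<close> in \<open>[1 - D, N + D]\<close>, and only \<open>2D\<close> of these lie outside \<open>[1, N]\<close>.
\<close>

lemma bounded_distance_equivalent_imp_card_le:
  fixes X :: "int \<Rightarrow> real" and A B :: "int set"
  assumes gap: "\<And>m n. m \<le> n \<Longrightarrow> of_int (n - m) \<le> X n - X m"
    and bde: "bounded_distance_equivalent (X ` A) (X ` B)"
  obtains C :: nat where "\<And>N. card (A \<inter> {1..int N}) \<le> card (B \<inter> {1..int N}) + C"
proof -
  from bde obtain c \<phi> where bij: "bij_betw \<phi> (X ` A) (X ` B)"
    and near: "\<forall>x\<in>X ` A. \<bar>x - \<phi> x\<bar> < c"
    unfolding bounded_distance_equivalent_def by blast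
  have gap_abs: "of_int \<bar>n - m\<bar> \<le> \<bar>X n - X m\<bar>" for m n
    using gap[of m n] gap[of n m] by linarith
  have "inj X"
  proof (rule injI)
    fix m n assume "X m = X n"
    with gap_abs[of n m] show "m = n" by simp
  qed
  have "\<exists>k\<in>B. X k = \<phi> (X n)" if "n \<in> A" for n
  proof -
    have "\<phi> (X n) \<in> X ` B"
      using bij that by (auto simp: bij_betw_def)
    then show ?thesis by auto
  qed
  then obtain f where f: "\<And>n. n \<in> A \<Longrightarrow> f n \<in> B" "\<And>n. n \<in> A \<Longrightarrow> X (f n) = \<phi> (X n)"
    by metis
  have inj_f: "inj_on f A"
  proof (rule inj_onI)
    fix m n assume *: "m \<in> A" "n \<in> A" "f m = f n"
    then have "\<phi> (X m) = \<phi> (X n)" by (metis f(2))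
    then have "X m = X n"
      using bij * by (auto simp: bij_betw_def dest: inj_onD)
    then show "m = n" using \<open>inj X\<close> by (simp add: inj_eq)
  qed
  define D where "D = nat \<lceil>c\<rceil>"
  have f_near: "\<bar>n - f n\<bar> \<le> int D" if "n \<in> A" for n
  proof -
    have "of_int \<bar>n - f n\<bar> < c"
      using gap_abs[of n "f n"] near f(2)[OF that] that by fastforce
    then show ?thesis unfolding D_def by linarith
  qed
  have "card (A \<inter> {1..int N}) \<le> card (B \<inter> {1..int N}) + 2 * D" for N
  proof -
    let ?E = "{1 - int D..0} \<union> {int N + 1..int N + int D}"
    have "f ` (A \<inter> {1..int N}) \<subseteq> (B \<inter> {1..int N}) \<union> ?E"
    proof
      fix k assume "k \<in> f ` (A \<inter> {1..int N})"
      then obtain n where "k = f n" "n \<in> A" "1 \<le> n" "n \<le> int N" by auto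
      with f(1)[of n] f_near[of n] show "k \<in> (B \<inter> {1..int N}) \<union> ?E"
        by auto
    qed
    then have "card (f ` (A \<inter> {1..int N})) \<le> card ((B \<inter> {1..int N}) \<union> ?E)"
      by (intro card_mono) auto
    also have "\<dots> \<le> card (B \<inter> {1..int N}) + card ?E"
      by (rule card_Un_le)
    also have "card ?E \<le> 2 * D"
      by (rule order.trans[OF card_Un_le]) simp
    finally show ?thesis
      by (simp add: card_image inj_on_subset[OF inj_f])
  qed
  then show ?thesis by (rule that)
qed


section \<open>Half-circle discrepancy of an irrational rotation\<close>

text \<open>
  The integer part of \<open>2n\<theta>\<close> is even exactly when \<open>n\<theta>\<close> lies in the left half \<open>[0, 1/2)\<close> of the
  circle \<open>\<real>/\<int>\<close>. In this form, adding \<open>q\<close> to \<open>n\<close> with \<open>q\<theta>\<close> close to an integer \<open>h\<close> adds the even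
  number \<open>2h\<close> to the integer part.
\<close>

definition half_turn_sign :: "real \<Rightarrow> int \<Rightarrow> int" where
  "half_turn_sign \<theta> n = (if even \<lfloor>2 * of_int n * \<theta>\<rfloor> then 1 else - 1)"

definition half_turn_balance :: "real \<Rightarrow> nat \<Rightarrow> int" where
  "half_turn_balance \<theta> N = (\<Sum>n=1..N. half_turn_sign \<theta> (int n))"

lemma odd_half_turn_balance: "odd (half_turn_balance \<theta> N) \<longleftrightarrow> odd N"
  by (induction N) (auto simp: half_turn_balance_def half_turn_sign_def)

text \<open>
  Dirichlet's theorem gives no control over the parity of \<open>q\<close>. With \<open>q = 2k + 1\<close> the claim says
  that \<open>k \<cdot> 2\<theta>\<close> comes close to \<open>-\<theta>\<close> modulo \<open>1\<close>, which is the density of the orbit of the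
  irrational number \<open>2\<theta>\<close>.
\<close>

lemma odd_near_return:
  fixes \<theta> \<epsilon> :: real
  assumes "\<theta> \<notin> \<rat>" "\<epsilon> > 0"
  obtains q :: nat and h :: int where "odd q" "\<bar>of_nat q * \<theta> - of_int h\<bar> < \<epsilon>"
proof -
  have "2 * \<theta> \<notin> \<rat>"
  proof
    assume "2 * \<theta> \<in> \<rat>"
    then have "2 * \<theta> / 2 \<in> \<rat>" by (intro Rats_divide) auto
    with assms(1) show False by simp
  qed
  from sequence_of_fractional_parts_is_dense[OF this assms(2), of "- \<theta>"]
  obtain h k :: int where k: "k > 0" "\<bar>of_int k * (2 * \<theta>) - of_int h - (- \<theta>)\<bar> < \<epsilon>"
    by blast
  have "of_nat (2 * nat k + 1) * \<theta> - of_int h = of_int k * (2 * \<theta>) - of_int h - (- \<theta>)"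
    using k(1) by (simp add: algebra_simps)
  with k(2) have "\<bar>of_nat (2 * nat k + 1) * \<theta> - of_int h\<bar> < \<epsilon>" by metis
  moreover have "odd (2 * nat k + 1)" by simp
  ultimately show ?thesis using that by blast
qed

lemma multiple_irrational_notin_Ints:
  fixes \<theta> :: real
  assumes "\<theta> \<notin> \<rat>" "n \<noteq> 0"
  shows "of_int n * \<theta> \<notin> \<int>"
proof
  assume "of_int n * \<theta> \<in> \<int>"
  then have "of_int n * \<theta> / of_int n \<in> \<rat>"
    using Ints_subset_Rats by (intro Rats_divide) auto
  with assms show False by simp
qed

text \<open>
  For \<open>n \<ge> 1\<close> the point \<open>n\<theta>\<close> is, by irrationality, neither \<open>0\<close> nor \<open>1/2\<close> modulo \<open>1\<close>, so a small
  perturbation does not push it across an end of its half circle; finitely many \<open>n\<close> share one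
  tolerance. At \<open>n = 0\<close> this fails, which is why the sums start at \<open>1\<close>.
\<close>

lemma half_turn_sign_stable:
  fixes \<theta> :: real
  assumes "\<theta> \<notin> \<rat>"
  shows "\<exists>\<epsilon>>0. \<forall>n\<in>{1..K}. \<forall>q h :: int.
           \<bar>of_int q * \<theta> - of_int h\<bar> < \<epsilon> \<longrightarrow> half_turn_sign \<theta> (n + q) = half_turn_sign \<theta> n"
proof -
  \<comment> \<open>the distance from \<open>n\<theta>\<close> to the nearest multiple of \<open>1/2\<close>\<close>
  define d where "d n = min (frac (2 * of_int n * \<theta>)) (1 - frac (2 * of_int n * \<theta>)) / 2" for n :: int
  define \<epsilon> where "\<epsilon> = Min (insert 1 (d ` {1..K}))"
  have d_pos: "d n > 0" if "n \<in> {1..K}" for n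
  proof -
    have "of_int (2 * n) * \<theta> \<notin> \<int>"
      using that assms by (intro multiple_irrational_notin_Ints) auto
    then have "frac (2 * of_int n * \<theta>) > 0"
      by (simp add: frac_gt_0_iff)
    with frac_lt_1[of "2 * of_int n * \<theta>"] show ?thesis
      by (simp add: d_def)
  qed
  then have "\<epsilon> > 0" by (simp add: \<epsilon>_def)
  moreover have "half_turn_sign \<theta> (n + q) = half_turn_sign \<theta> n"
    if n: "n \<in> {1..K}" and q: "\<bar>of_int q * \<theta> - of_int h\<bar> < \<epsilon>" for n q h :: int
  proof -
    have "\<epsilon> \<le> d n" using n unfolding \<epsilon>_def by (intro Min_le) auto
    with q have "\<bar>of_int q * \<theta> - of_int h\<bar> < d n" by linarith
    then have near: "2 * \<bar>of_int q * \<theta> - of_int h\<bar> < frac (2 * of_int n * \<theta>)"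
      "2 * \<bar>of_int q * \<theta> - of_int h\<bar> < 1 - frac (2 * of_int n * \<theta>)"
      by (simp_all add: d_def)
    have floor_shift: "\<lfloor>x + 2 * y\<rfloor> = \<lfloor>x\<rfloor> + 2 * h"
      if "2 * \<bar>y - of_int h\<bar> < frac x" "2 * \<bar>y - of_int h\<bar> < 1 - frac x" for x y :: real
    proof -
      define u where "u = y - of_int h"
      have "x + 2 * y = (x + 2 * u) + of_int (2 * h)" by (simp add: u_def)
      then have "\<lfloor>x + 2 * y\<rfloor> = \<lfloor>x + 2 * u\<rfloor> + 2 * h" by (simp only: floor_add_int)
      moreover have "\<lfloor>x + 2 * u\<rfloor> = \<lfloor>x\<rfloor>"
      proof (rule floor_unique)
        have "2 * \<bar>u\<bar> < x - of_int \<lfloor>x\<rfloor>" "2 * \<bar>u\<bar> < 1 - (x - of_int \<lfloor>x\<rfloor>)"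
          using that unfolding u_def frac_def by blast+
        then show "of_int \<lfloor>x\<rfloor> \<le> x + 2 * u" "x + 2 * u < of_int \<lfloor>x\<rfloor> + 1"
          using abs_ge_self[of u] abs_ge_minus_self[of u] by linarith+
      qed
      ultimately show ?thesis by (simp only:)
    qed
    have "\<lfloor>2 * of_int n * \<theta> + 2 * (of_int q * \<theta>)\<rfloor> = \<lfloor>2 * of_int n * \<theta>\<rfloor> + 2 * h"
      using near by (rule floor_shift)
    moreover have "2 * of_int (n + q) * \<theta> = 2 * of_int n * \<theta> + 2 * (of_int q * \<theta>)"
      by (simp add: algebra_simps)
    ultimately have "\<lfloor>2 * of_int (n + q) * \<theta>\<rfloor> = \<lfloor>2 * of_int n * \<theta>\<rfloor> + 2 * h"
      by (simp only:)
    then show ?thesis by (simp add: half_turn_sign_def)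
  qed
  ultimately show ?thesis by blast
qed

text \<open>
  A bounded balance would have extreme values, and a nearly periodic translation by \<open>q\<close> adds the
  balance at \<open>q\<close> to both of them. That balance must then vanish, which parity forbids for odd \<open>q\<close>.
\<close>

theorem half_turn_balance_unbounded:
  fixes \<theta> :: real
  assumes "\<theta> \<notin> \<rat>"
  shows "\<exists>N. \<bar>half_turn_balance \<theta> N\<bar> > C"
proof (rule ccontr)
  let ?S = "half_turn_balance \<theta>"
  assume "\<not> ?thesis"
  then have "range ?S \<subseteq> {- C..C}"
    by (auto simp: abs_le_iff not_less) (metis minus_le_iff abs_le_D2 abs_le_iff)+
  then have fin: "finite (range ?S)" by (rule finite_subset) simp
  obtain N1 where N1: "\<And>N. ?S N \<le> ?S N1"
    using Max_in[OF fin] Max_ge[OF fin] by (metis empty_iff rangeE rangeI)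
  obtain N2 where N2: "\<And>N. ?S N2 \<le> ?S N"
    using Min_in[OF fin] Min_le[OF fin] by (metis empty_iff rangeE rangeI)
  from half_turn_sign_stable[OF assms, of "int (max N1 N2)"]
  obtain \<epsilon> where "\<epsilon> > 0" and stable: "\<And>n q h :: int. n \<in> {1..int (max N1 N2)} \<Longrightarrow>
      \<bar>of_int q * \<theta> - of_int h\<bar> < \<epsilon> \<Longrightarrow> half_turn_sign \<theta> (n + q) = half_turn_sign \<theta> n"
    by blast
  obtain q h where "odd q" and q: "\<bar>of_nat q * \<theta> - of_int h\<bar> < \<epsilon>"
    using odd_near_return[OF assms \<open>\<epsilon> > 0\<close>] by blast
  have split: "?S (N + q) = ?S q + ?S N" if "N \<le> max N1 N2" for N
    using that
  proof (induction N)
    case 0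
    then show ?case by (simp add: half_turn_balance_def)
  next
    case (Suc N)
    have "half_turn_sign \<theta> (int (Suc N) + int q) = half_turn_sign \<theta> (int (Suc N))"
      using Suc.prems q by (intro stable[where h = h]) auto
    with Suc show ?case by (simp add: half_turn_balance_def algebra_simps)
  qed
  have "?S q \<le> 0" using split[of N1] N1[of "N1 + q"] by simp
  moreover have "?S q \<ge> 0" using split[of N2] N2[of "N2 + q"] by simp
  ultimately have "?S q = 0" by simp
  with odd_half_turn_balance[of \<theta> q] \<open>odd q\<close> show False by simp
qed


section \<open>The Fibonacci chain as a coding of the golden rotation\<close>

lemma golden_bounds: "1 < golden" "golden < 2"
proof -
  have "1 < sqrt 5" by simp
  moreover have "sqrt 5 < 3" by (rule real_less_lsqrt) auto
  ultimately show "1 < golden" "golden < 2" by (auto simp: golden_def)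
qed

lemma golden_square: "golden * golden = golden + 1"
  by (simp add: golden_def field_simps)

lemma inverse_golden: "1 / golden = golden - 1"
  using golden_bounds golden_square by (simp add: field_simps)

text \<open>
  A rational root of the monic polynomial \<open>x\<^sup>2 - x - 1\<close> would be an integer, but there is none
  between \<open>1\<close> and \<open>2\<close>.
\<close>

lemma golden_irrational: "golden \<notin> \<rat>"
proof
  assume "golden \<in> \<rat>"
  then obtain m n :: nat where n: "n \<noteq> 0" and eq: "\<bar>golden\<bar> = real m / real n"
    and "coprime m n" by (rule Rats_abs_nat_div_natE)
  have "golden = real m / real n" using eq golden_bounds by simp
  then have "golden * real n = real m" using n by (metis nonzero_eq_divide_eq of_nat_eq_0_iff)
  moreover have "(golden * real n) * (golden * real n) = (golden * golden) * real n * real n"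
    by (simp add: algebra_simps)
  ultimately have "real m * real m = golden * real n * real n + real n * real n"
    by (simp add: golden_square algebra_simps)
  with \<open>golden * real n = real m\<close> have "real (m * m) = real (n * (m + n))"
    by (simp add: algebra_simps)
  then have "m * m = n * (m + n)" by (simp only: of_nat_eq_iff)
  then have "n dvd m * m" by simp
  with \<open>coprime m n\<close> have "n = 1"
    by (metis coprime_commute coprime_dvd_mult_left_iff coprime_common_divisor_nat dvd_refl)
  with \<open>golden * real n = real m\<close> golden_bounds have "1 < m" "m < 2" by auto
  then show False by simp
qed

text \<open>
  The points \<open>a + b\<tau>\<close> with \<open>-1/\<tau> \<le> a - b/\<tau> < 1\<close> in increasing order, numbered by
  \<open>n = a + b - 1\<close>. For fixed \<open>n\<close>, putting \<open>p = 2n - a\<close> gives \<open>a - b/\<tau> = \<tau>(n\<tau> - p) - 1/\<tau>\<close>, so the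
  window condition becomes \<open>0 \<le> n\<tau> - p < 1\<close> and forces \<open>p\<close> to be the integer part of \<open>n\<tau>\<close>. The
  formula below is \<open>a + b\<tau>\<close> for \<open>a = 2n - p\<close> and \<open>b = 1 - n + p\<close>.
\<close>

definition fib_chain :: "int \<Rightarrow> real" where
  "fib_chain n = golden + (2 - golden) * of_int n + (golden - 1) * of_int \<lfloor>of_int n * golden\<rfloor>"

text \<open>
  Since \<open>\<tau> > 1\<close>, the integer part of \<open>n\<tau>\<close> grows by at least \<open>1\<close> per step, so the chain advances by
  at least \<open>(2 - \<tau>) + (\<tau> - 1) = 1\<close>.
\<close>

lemma fib_chain_gap:
  assumes "m \<le> n"
  shows "of_int (n - m) \<le> fib_chain n - fib_chain m"
proof -
  have "of_int m * golden + of_int (n - m) * 1 \<le> of_int m * golden + of_int (n - m) * golden"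
    using assms golden_bounds by (intro add_left_mono mult_left_mono) auto
  also have "\<dots> = of_int n * golden" by (simp add: algebra_simps)
  finally have "of_int m * golden + of_int (n - m) \<le> of_int n * golden" by simp
  then have "n - m \<le> \<lfloor>of_int n * golden\<rfloor> - \<lfloor>of_int m * golden\<rfloor>"
    using floor_mono floor_add_int by (metis add.commute le_diff_eq)
  then have "(golden - 1) * of_int (n - m)
      \<le> (golden - 1) * of_int (\<lfloor>of_int n * golden\<rfloor> - \<lfloor>of_int m * golden\<rfloor>)"
    using golden_bounds by (intro mult_left_mono) (auto simp only: of_int_le_iff)
  then show ?thesis by (simp add: fib_chain_def algebra_simps)
qed

text \<open>
  The affine map \<open>t \<mapsto> \<tau>t - 1/\<tau>\<close> carries the unit interval onto the full window \<open>[-1/\<tau>, 1)\<close>, and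
  in the coordinate \<open>t\<close> the \<open>n\<close>-th point of the chain sits at the fractional part of \<open>n\<tau>\<close>.
\<close>

lemma cut_and_project_fibonacci_eq:
  assumes lo: "0 \<le> lo" and hi: "hi \<le> 1"
  shows "cut_and_project fibonacci_lattice {golden * lo - 1 / golden ..< golden * hi - 1 / golden}
       = fib_chain ` {n. frac (of_int n * golden) \<in> {lo..<hi}}"
    (is "?L = ?R")
proof -
  have in_window: "of_int a - of_int b / golden \<in> {golden * lo - 1 / golden ..< golden * hi - 1 / golden}
      \<longleftrightarrow> of_int (a + b - 1) * golden - of_int (2 * (a + b - 1) - a) \<in> {lo..<hi}" for a b :: int
  proof -
    let ?t = "of_int (a + b - 1) * golden - of_int (2 * (a + b - 1) - a)"
    have "golden * ?t = of_int (a + b - 1) * (golden * golden) - golden * of_int (2 * (a + b - 1) - a)"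
      by (simp add: algebra_simps)
    then have "golden * ?t - (golden - 1) = of_int a - of_int b * (golden - 1)"
      by (simp add: golden_square algebra_simps)
    moreover have "of_int b / golden = of_int b * (golden - 1)"
      using inverse_golden by (metis times_divide_eq_right mult.right_neutral)
    ultimately have "of_int a - of_int b / golden = golden * ?t - 1 / golden"
      using inverse_golden by simp
    then show ?thesis using golden_bounds by auto
  qed
  have floor_eq: "\<lfloor>x\<rfloor> = p \<and> frac x \<in> {lo..<hi} \<longleftrightarrow> x - of_int p \<in> {lo..<hi}" for x :: real and p
  proof -
    have "\<lfloor>x\<rfloor> = p" if "x - of_int p \<in> {lo..<hi}"
      using that lo hi by (intro floor_unique) auto
    then show ?thesis by (auto simp: frac_def)
  qed
  show ?thesis
  proof (intro equalityI subsetI)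
    fix x assume "x \<in> ?L"
    then obtain a b :: int where x: "x = of_int a + of_int b * golden"
      and "of_int a - of_int b / golden \<in> {golden * lo - 1 / golden ..< golden * hi - 1 / golden}"
      by (auto simp: cut_and_project_def fibonacci_lattice_def)
    define n where "n = a + b - 1"
    have *: "\<lfloor>of_int n * golden\<rfloor> = 2 * n - a" "frac (of_int n * golden) \<in> {lo..<hi}"
      using \<open>of_int a - _ \<in> _\<close> unfolding in_window floor_eq[symmetric] n_def by blast+
    have "x = fib_chain n"
      unfolding fib_chain_def *(1) x by (simp add: n_def algebra_simps)
    with *(2) show "x \<in> ?R" by blast
  next
    fix x assume "x \<in> ?R"
    then obtain n where x: "x = fib_chain n" and n: "frac (of_int n * golden) \<in> {lo..<hi}" by blast
    define a b where "a = 2 * n - \<lfloor>of_int n * golden\<rfloor>" and "b = n + 1 - a"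
    have n_eq: "a + b - 1 = n" "2 * n - a = \<lfloor>of_int n * golden\<rfloor>" by (auto simp: a_def b_def)
    have "of_int a - of_int b / golden \<in> {golden * lo - 1 / golden ..< golden * hi - 1 / golden}"
      unfolding in_window n_eq floor_eq[symmetric] using n by blast
    moreover have "x = of_int a + of_int b * golden"
      unfolding x fib_chain_def a_def b_def by (simp add: algebra_simps)
    moreover have "(of_int a + of_int b * golden, of_int a - of_int b / golden) \<in> fibonacci_lattice"
      unfolding fibonacci_lattice_def mem_Collect_eq
      by (rule exI[of _ a], rule exI[of _ b]) simp
    ultimately show "x \<in> ?L"
      unfolding cut_and_project_def by force
  qed
qed

lemma frac_less_half_iff: "frac x < 1 / 2 \<longleftrightarrow> even \<lfloor>2 * x\<rfloor>" for x :: real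
proof -
  have "\<lfloor>2 * x\<rfloor> = 2 * \<lfloor>x\<rfloor> + (if frac x < 1 / 2 then 0 else 1)"
    unfolding frac_def by (simp split: if_splits) linarith
  then show ?thesis by simp
qed

lemma half_turn_sign_eq_1_iff:
  "half_turn_sign \<theta> n = 1 \<longleftrightarrow> frac (of_int n * \<theta>) < 1 / 2"
  unfolding half_turn_sign_def frac_less_half_iff by (simp add: mult.assoc)

lemma half_fibonacci1_eq: "half_fibonacci1 = fib_chain ` {n. half_turn_sign golden n = 1}"
proof -
  have "window1 = {golden * 0 - 1 / golden ..< golden * (1 / 2) - 1 / golden}"
    unfolding window1_def inverse_golden by (simp add: field_simps)
  moreover have "half_turn_sign golden n = 1 \<longleftrightarrow> frac (of_int n * golden) \<in> {0..<1 / 2}" for n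
    unfolding half_turn_sign_eq_1_iff by simp
  ultimately show ?thesis
    unfolding half_fibonacci1_def using cut_and_project_fibonacci_eq[of 0 "1 / 2"] by simp
qed

lemma half_fibonacci2_eq: "half_fibonacci2 = fib_chain ` {n. half_turn_sign golden n \<noteq> 1}"
proof -
  have "window2 = {golden * (1 / 2) - 1 / golden ..< golden * 1 - 1 / golden}"
    unfolding window2_def inverse_golden by (simp add: field_simps)
  moreover have "half_turn_sign golden n \<noteq> 1 \<longleftrightarrow> frac (of_int n * golden) \<in> {1 / 2..<1}" for n
    unfolding half_turn_sign_eq_1_iff by (auto simp: frac_lt_1)
  ultimately show ?thesis
    unfolding half_fibonacci2_def using cut_and_project_fibonacci_eq[of "1 / 2" 1] by simp
qed

lemma half_turn_balance_eq_card_diff: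
  "half_turn_balance \<theta> N = int (card ({n. half_turn_sign \<theta> n = 1} \<inter> {1..int N}))
     - int (card ({n. half_turn_sign \<theta> n \<noteq> 1} \<inter> {1..int N}))"
proof (induction N)
  case 0
  then show ?case by (simp add: half_turn_balance_def)
next
  case (Suc N)
  have "{1..int (Suc N)} = insert (int (Suc N)) {1..int N}" by auto
  with Suc show ?case
    by (simp add: half_turn_balance_def Int_insert_right)
      (simp add: half_turn_sign_def)
qed

theorem theorem6p4:
  shows "\<not> bounded_distance_equivalent half_fibonacci1 half_fibonacci2"
proof
  let ?A = "{n. half_turn_sign golden n = 1}" and ?B = "{n. half_turn_sign golden n \<noteq> 1}"
  assume "bounded_distance_equivalent half_fibonacci1 half_fibonacci2"
  then have bde: "bounded_distance_equivalent (fib_chain ` ?A) (fib_chain ` ?B)"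
    unfolding half_fibonacci1_eq half_fibonacci2_eq .
  obtain C where C: "\<And>N. card (?A \<inter> {1..int N}) \<le> card (?B \<inter> {1..int N}) + C"
    using bounded_distance_equivalent_imp_card_le[OF fib_chain_gap bde] by blast
  obtain C' where C': "\<And>N. card (?B \<inter> {1..int N}) \<le> card (?A \<inter> {1..int N}) + C'"
    using bounded_distance_equivalent_imp_card_le
      [OF fib_chain_gap bounded_distance_equivalent_sym[OF bde]] by blast
  obtain N where "\<bar>half_turn_balance golden N\<bar> > int (max C C')"
    using half_turn_balance_unbounded[OF golden_irrational] by blast
  with C[of N] C'[of N] show False
    unfolding half_turn_balance_eq_card_diff by linarith
qed

end
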